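(* Let $J$ be a Jacobi matrix with parameters $a_n>0$, $b_n\in\mathbb{R}$ satisfying $a_n\to1$, $b_n\to0$, and let $z\in\mathbb{D}$ be such that $z+z^{-1}$ is not an eigenvalue of $J$. Put $\widetilde w_n(z)=z^{-n}w_n(z)$ and $c_n(z)=z^n p_n\bigl(z+\tfrac1z\bigr)$. Then $\widetilde w_n(z)$ has a finite nonzero limit as $n\to\infty$ if and only if $c_n(z)$ has a finite nonzero limit as $n\to\infty$, and if either happens, $$\lim_{n\to\infty} c_n(z)=\frac{u(z)}{1-z^2},\qquad\text{where } u(z)^{-1}\equiv\lim_{n\to\infty}\widetilde w_n(z).$$
   Context: $\mathbb{D}=\{z\in\mathbb{C}: |z|<1\}$. $J$ is the bounded selfadjoint operator on $\ell^2(\{1,2,\dots\})$ given by the tridiagonal matrix with $J_{nn}=b_n$ and $J_{n,n+1}=J_{n+1,n}=a_n$ ($n\ge1$); $\{\delta_n\}$ is the standard basis. The orthonormal polynomials are defined by $p_{-1}=0$, $p_0=1$, $x p_n(x)=a_{n+1}p_{n+1}(x)+b_{n+1}p_n(x)+a_n p_{n-1}(x)$ ($n\ge0$). The Weyl solution is $w_n(z)=\langle\delta_n,(z+z^{-1}-J)^{-1}\delta_1\rangle$. At $z=0$, $c_n$ is a polynomial in $z$ and $\widetilde w_n$ has a removable singularity; the values at $z=0$ are the resulting ones. *)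

theory Defs
  imports "HOL-Analysis.Analysis" "HOL-Computational_Algebra.Polynomial"
begin

text \<open>
  The sequences \<open>a\<close>, \<open>b\<close> and the vectors of \<open>\<ell>\<^sup>2({1, 2, \<dots>})\<close> are indexed by
  \<open>nat\<close>, starting at 1.  The values \<open>a 0\<close> and \<open>b 0\<close> are never used; vectors carry the
  junk value 0 at index 0, so that equality of vectors is equality of functions.
\<close>

definition ell2 :: "(nat \<Rightarrow> complex) set" where
  "ell2 = {x. x 0 = 0 \<and> (\<lambda>n. (cmod (x n))\<^sup>2) summable_on {1..}}"

definition ell2_inner :: "(nat \<Rightarrow> complex) \<Rightarrow> (nat \<Rightarrow> complex) \<Rightarrow> complex" where
  "ell2_inner x y = (\<Sum>\<^sub>\<infinity>n\<in>{1..}. cnj (x n) * y n)"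

definition delta :: "nat \<Rightarrow> nat \<Rightarrow> complex" where
  "delta n = (\<lambda>m. if m = n \<and> 1 \<le> n then 1 else 0)"

definition jacobi_matrix :: "(nat \<Rightarrow> real) \<Rightarrow> (nat \<Rightarrow> real) \<Rightarrow> nat \<Rightarrow> nat \<Rightarrow> real" where
  "jacobi_matrix a b m n =
     (if m = n then b n
      else if n = Suc m then a m
      else if m = Suc n then a n
      else 0)"

definition jacobi_op ::
    "(nat \<Rightarrow> real) \<Rightarrow> (nat \<Rightarrow> real) \<Rightarrow> (nat \<Rightarrow> complex) \<Rightarrow> nat \<Rightarrow> complex" where
  "jacobi_op a b x =
     (\<lambda>n. if n = 0 then 0
          else (\<Sum>\<^sub>\<infinity>m\<in>{1..}. complex_of_real (jacobi_matrix a b n m) * x m))"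

lemma jacobi_op_apply:
  assumes "x 0 = 0" "n \<ge> 1"
  shows "jacobi_op a b x n =
           of_real (a n) * x (n + 1) + of_real (b n) * x n + of_real (a (n - 1)) * x (n - 1)"
proof -
  obtain k where n: "n = Suc k"
    using assms(2) by (cases n) auto
  let ?f = "\<lambda>m. complex_of_real (jacobi_matrix a b n m) * x m"
  have "infsum ?f {1..} = infsum ?f {k, n, Suc n}"
    by (rule infsum_cong_neutral) (use n assms in \<open>auto simp: jacobi_matrix_def not_less_eq_eq\<close>)
  also have "\<dots> = of_real (a n) * x (n + 1) + of_real (b n) * x n + of_real (a k) * x k"
    by (simp add: n jacobi_matrix_def)
  finally show ?thesis
    using assms n by (simp add: jacobi_op_def)
qed

definition jacobi_eigenvalue :: "(nat \<Rightarrow> real) \<Rightarrow> (nat \<Rightarrow> real) \<Rightarrow> complex \<Rightarrow> bool" where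
  "jacobi_eigenvalue a b l \<longleftrightarrow>
     (\<exists>x\<in>ell2. x \<noteq> (\<lambda>_. 0) \<and> jacobi_op a b x = (\<lambda>n. l * x n))"

definition jacobi_resolvent ::
    "(nat \<Rightarrow> real) \<Rightarrow> (nat \<Rightarrow> real) \<Rightarrow> complex \<Rightarrow> (nat \<Rightarrow> complex) \<Rightarrow> nat \<Rightarrow> complex" where
  "jacobi_resolvent a b l = the_inv_into ell2 (\<lambda>x n. l * x n - jacobi_op a b x n)"

definition weyl :: "(nat \<Rightarrow> real) \<Rightarrow> (nat \<Rightarrow> real) \<Rightarrow> nat \<Rightarrow> complex \<Rightarrow> complex" where
  "weyl a b n z = ell2_inner (delta n) (jacobi_resolvent a b (z + inverse z) (delta 1))"

fun orth_poly :: "(nat \<Rightarrow> real) \<Rightarrow> (nat \<Rightarrow> real) \<Rightarrow> nat \<Rightarrow> real poly" where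
  "orth_poly a b 0 = 1"
| "orth_poly a b (Suc 0) = smult (inverse (a 1)) [:- b 1, 1:]"
| "orth_poly a b (Suc (Suc n)) =
     smult (inverse (a (n + 2)))
       ([:- b (n + 2), 1:] * orth_poly a b (n + 1) - smult (a (n + 1)) (orth_poly a b n))"

text \<open>The three-term recurrence, with the term for index \<open>-1\<close> equal to 0:\<close>

lemma orth_poly_recurrence:
  assumes "\<And>n. n \<ge> 1 \<Longrightarrow> a n > 0"
  shows "[:0, 1:] * orth_poly a b n =
           smult (a (n + 1)) (orth_poly a b (n + 1)) + smult (b (n + 1)) (orth_poly a b n)
           + (if n = 0 then 0 else smult (a n) (orth_poly a b (n - 1)))"
proof -
  have "a (Suc m) \<noteq> 0" for m
    using assms[of "Suc m"] by simp
  then show ?thesis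
    by (cases n) (simp_all add: algebra_simps)
qed

text \<open>
  The expressions \<open>z ^ n * p\<^sub>n (z + 1/z)\<close> and \<open>w\<^sub>n z / z ^ n\<close> make sense
  for \<open>z \<noteq> 0\<close> only; the values at the removable singularity 0 are the limits there.
\<close>

definition c_norm :: "(nat \<Rightarrow> real) \<Rightarrow> (nat \<Rightarrow> real) \<Rightarrow> nat \<Rightarrow> complex \<Rightarrow> complex" where
  "c_norm a b n z =
     (let f = (\<lambda>\<zeta>. \<zeta> ^ n * poly (map_poly complex_of_real (orth_poly a b n)) (\<zeta> + inverse \<zeta>))
      in if z = 0 then Lim (at 0) f else f z)"

definition weyl_norm :: "(nat \<Rightarrow> real) \<Rightarrow> (nat \<Rightarrow> real) \<Rightarrow> nat \<Rightarrow> complex \<Rightarrow> complex" where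
  "weyl_norm a b n z =
     (let f = (\<lambda>\<zeta>. inverse (\<zeta> ^ n) * weyl a b n \<zeta>)
      in if z = 0 then Lim (at 0) f else f z)"

definition nonzero_limit :: "(nat \<Rightarrow> complex) \<Rightarrow> bool" where
  "nonzero_limit X \<longleftrightarrow> (\<exists>L. L \<noteq> 0 \<and> X \<longlonglongrightarrow> L)"

definition jost_u :: "(nat \<Rightarrow> real) \<Rightarrow> (nat \<Rightarrow> real) \<Rightarrow> complex \<Rightarrow> complex" where
  "jost_u a b z = inverse (lim (\<lambda>n. weyl_norm a b n z))"

end

theory Submission
  imports Defs
begin

text \<open>
  Write \<open>y n\<close> and \<open>c n\<close> for the normalized Weyl solution and the normalized orthogonal
  polynomials at \<open>z\<close>.  Everything follows from the identity
  \<open>a n * (c n * y n - z\<^sup>2 * c (n - 1) * y (n + 1)) = 1\<close> (\<open>normalized_wronskian\<close>), which expresses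
  that the Wronskian of the two solutions of the three-term recurrence is constant
  (\<open>wronskian_constant\<close>).  If \<open>y\<close> has a nonzero limit \<open>L\<close>, the identity is a recursion for
  \<open>c\<close> with multiplier tending to \<open>z\<^sup>2\<close> and source term tending to \<open>1 / L\<close>, so \<open>c\<close> converges
  to \<open>1 / (L * (1 - z\<^sup>2))\<close>.  If \<open>c\<close> has a nonzero limit, it is in the same way a recursion
  for \<open>y\<close>, but one that runs backwards.  Such a recursion has solutions growing like
  \<open>z ^ (- 2 * n)\<close>; these are excluded because \<open>z ^ n * y n\<close>, the Weyl solution, is square
  summable and hence tends to 0.

  For the identity one has to know that the Weyl solution is square summable and solves its
  equation, that is, that \<open>\<delta>\<^sub>1\<close> is in the range of \<open>z + 1/z - J\<close> and has only one
  preimage.  Since \<open>J\<close> is asymptotically free, the ratios of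
  consecutive entries of a decaying solution can be found near infinity as the attracting
  backward orbit of a Riccati equation (\<open>riccati_solution\<close>); the decaying solution is continued
  down to the first index, where it fails the eigenvalue equation because \<open>z + 1/z\<close> is not an
  eigenvalue, and this failure is normalized to 1 (\<open>green_vector_exists\<close>).  Uniqueness is again
  the constancy of the Wronskian (\<open>green_vector_imp_no_eigenvector\<close>).

  At \<open>z = 0\<close> the two sequences are limits of functions of \<open>\<zeta>\<close>.  Near 0 the Riccati equation is
  solvable from the first index on, with solution tending to 1, which gives
  \<open>y n = a 1 * \<dots> * a (n - 1)\<close> (\<open>weyl_norm_at_0\<close>), while \<open>c n\<close> is the inverse of
  \<open>a 1 * \<dots> * a n\<close> (\<open>c_norm_at_0\<close>).  So the identity also holds there.
\<close>

section \<open>Asymptotically constant linear recursions\<close>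

text \<open>
  Once \<open>e n < \<epsilon> * (1 - r)\<close>, the excess \<open>s n - \<epsilon>\<close> is multiplied by at most \<open>r\<close> in
  each step.
\<close>
lemma tendsto_0_of_forward_contraction:
  fixes s e :: "nat \<Rightarrow> real"
  assumes r: "0 \<le> r" "r < 1" and s: "\<And>n. 0 \<le> s n" and e: "e \<longlonglongrightarrow> 0"
    and step: "\<forall>\<^sub>F n in sequentially. s (Suc n) \<le> r * s n + e n"
  shows "s \<longlonglongrightarrow> 0"
proof (rule order_tendstoI)
  fix y :: real assume "y < 0"
  then show "\<forall>\<^sub>F n in sequentially. y < s n"
    using s by (auto intro!: always_eventually intro: less_le_trans)
next
  fix y :: real assume "0 < y"
  define \<epsilon> where "\<epsilon> = y / 2"
  have \<epsilon>: "0 < \<epsilon>" using \<open>0 < y\<close> by (simp add: \<epsilon>_def)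
  then have "0 < \<epsilon> * (1 - r)" using r by simp
  with e have "\<forall>\<^sub>F n in sequentially. e n < \<epsilon> * (1 - r)"
    by (rule order_tendstoD(2))
  with step have "\<forall>\<^sub>F n in sequentially. s (Suc n) - \<epsilon> \<le> r * (s n - \<epsilon>)"
    by eventually_elim (simp add: algebra_simps)
  then obtain N where N: "\<And>n. n \<ge> N \<Longrightarrow> s (Suc n) - \<epsilon> \<le> r * (s n - \<epsilon>)"
    unfolding eventually_sequentially by blast
  have iter: "s (k + N) - \<epsilon> \<le> r ^ k * (s N - \<epsilon>)" for k
  proof (induction k)
    case (Suc k)
    have "s (Suc k + N) - \<epsilon> \<le> r * (s (k + N) - \<epsilon>)" using N[of "k + N"] by simp
    also have "\<dots> \<le> r * (r ^ k * (s N - \<epsilon>))" by (intro mult_left_mono Suc r)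
    finally show ?case by (simp add: mult.assoc)
  qed simp
  have "(\<lambda>k. r ^ k * (s N - \<epsilon>)) \<longlonglongrightarrow> 0"
    using r by (intro tendsto_mult_left_zero LIMSEQ_realpow_zero)
  then have "\<forall>\<^sub>F k in sequentially. r ^ k * (s N - \<epsilon>) < \<epsilon>"
    using \<epsilon> by (rule order_tendstoD(2))
  then have "\<forall>\<^sub>F k in sequentially. s (k + N) < y"
  proof eventually_elim
    case (elim k)
    then show ?case using iter[of k] by (simp add: \<epsilon>_def)
  qed
  then show "\<forall>\<^sub>F n in sequentially. s n < y"
    by (rule eventually_sequentially_seg[THEN iffD1])
qed

text \<open>
  Here a bound on \<open>s\<close> at a far index is transported back to \<open>n\<close>, and the far value has to be
  controlled: this is the purpose of the growth condition, which makes the contribution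
  \<open>r ^ k * s (k + n)\<close> of the far end vanish.  Without it the geometrically growing
  \<open>s n = r ^ (- n)\<close> would be a counterexample.
\<close>
lemma tendsto_0_of_backward_contraction:
  fixes s e :: "nat \<Rightarrow> real"
  assumes r: "0 < r" "r < 1" and s: "\<And>n. 0 \<le> s n" and e: "e \<longlonglongrightarrow> 0"
    and growth: "(\<lambda>n. r ^ n * s n) \<longlonglongrightarrow> 0"
    and step: "\<forall>\<^sub>F n in sequentially. s n \<le> r * s (Suc n) + e n"
  shows "s \<longlonglongrightarrow> 0"
proof (rule order_tendstoI)
  fix y :: real assume "y < 0"
  then show "\<forall>\<^sub>F n in sequentially. y < s n"
    using s by (auto intro!: always_eventually intro: less_le_trans)
next
  fix y :: real assume "0 < y"
  define \<epsilon> where "\<epsilon> = y / 2"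
  have \<epsilon>: "0 < \<epsilon>" using \<open>0 < y\<close> by (simp add: \<epsilon>_def)
  then have "0 < \<epsilon> * (1 - r)" using r by simp
  with e have "\<forall>\<^sub>F n in sequentially. e n < \<epsilon> * (1 - r)"
    by (rule order_tendstoD(2))
  with step have "\<forall>\<^sub>F n in sequentially. s n - \<epsilon> \<le> r * (s (Suc n) - \<epsilon>)"
    by eventually_elim (simp add: algebra_simps)
  then obtain N where N: "\<And>n. n \<ge> N \<Longrightarrow> s n - \<epsilon> \<le> r * (s (Suc n) - \<epsilon>)"
    unfolding eventually_sequentially by blast
  have "s n < y" if "n \<ge> N" for n
  proof -
    have iter: "s n - \<epsilon> \<le> r ^ k * (s (k + n) - \<epsilon>)" for k
    proof (induction k)
      case (Suc k)
      have "r ^ k * (s (k + n) - \<epsilon>) \<le> r ^ k * (r * (s (Suc (k + n)) - \<epsilon>))"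
        using N[of "k + n"] that r by (intro mult_left_mono) auto
      then show ?case using Suc by (simp add: algebra_simps)
    qed simp
    have "(\<lambda>k. inverse (r ^ n) * (r ^ (k + n) * s (k + n)) - r ^ k * \<epsilon>) \<longlonglongrightarrow> inverse (r ^ n) * 0 - 0 * \<epsilon>"
      using r by (intro tendsto_intros LIMSEQ_realpow_zero LIMSEQ_ignore_initial_segment[OF growth]) auto
    also have "(\<lambda>k. inverse (r ^ n) * (r ^ (k + n) * s (k + n)) - r ^ k * \<epsilon>)
        = (\<lambda>k. r ^ k * (s (k + n) - \<epsilon>))"
      using r by (simp add: power_add field_simps)
    finally have "s n - \<epsilon> \<le> 0"
      using iter by (intro LIMSEQ_le_const) auto
    then show ?thesis using \<epsilon> by (simp add: \<epsilon>_def)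
  qed
  then show "\<forall>\<^sub>F n in sequentially. s n < y"
    unfolding eventually_sequentially by blast
qed

text \<open>
  The limit is the fixed point of the limiting map \<open>X \<mapsto> F + G * X\<close>; the distance to it obeys
  a perturbed contraction.
\<close>
lemma tendsto_of_forward_recursion:
  fixes x f g :: "nat \<Rightarrow> 'a::real_normed_field"
  assumes f: "f \<longlonglongrightarrow> F" and g: "g \<longlonglongrightarrow> G" and G: "norm G < 1"
    and rec: "\<forall>\<^sub>F n in sequentially. x (Suc n) = f n + g n * x n"
  shows "x \<longlonglongrightarrow> F / (1 - G)"
proof -
  define X where "X = F / (1 - G)"
  have X: "X = F + G * X"
  proof -
    have "1 - G \<noteq> 0" using G by auto
    then show ?thesis by (simp add: X_def field_simps)
  qed
  obtain r where r: "norm G < r" "r < 1" using dense[OF G] by blast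
  then have "0 \<le> r" using norm_ge_zero[of G] by linarith
  have "(\<lambda>n. norm (f n + g n * X - X)) \<longlonglongrightarrow> norm (F + G * X - X)"
    by (intro tendsto_intros f g)
  then have e: "(\<lambda>n. norm (f n + g n * X - X)) \<longlonglongrightarrow> 0" using X by simp
  have "\<forall>\<^sub>F n in sequentially. norm (g n) < r"
    using tendsto_norm[OF g] r(1) by (rule order_tendstoD(2))
  with rec have "\<forall>\<^sub>F n in sequentially. norm (x (Suc n) - X)
      \<le> r * norm (x n - X) + norm (f n + g n * X - X)"
  proof eventually_elim
    case (elim n)
    have "x (Suc n) - X = g n * (x n - X) + (f n + g n * X - X)"
      using elim by (simp add: algebra_simps)
    then have "norm (x (Suc n) - X) \<le> norm (g n) * norm (x n - X) + norm (f n + g n * X - X)"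
      by (metis norm_mult norm_triangle_ineq)
    also have "norm (g n) * norm (x n - X) \<le> r * norm (x n - X)"
      using elim by (intro mult_right_mono) auto
    finally show ?case by simp
  qed
  from tendsto_0_of_forward_contraction[OF \<open>0 \<le> r\<close> r(2) _ e this]
  show ?thesis by (simp add: tendsto_norm_zero_iff LIM_zero_iff X_def)
qed

lemma tendsto_of_backward_recursion:
  fixes x f g :: "nat \<Rightarrow> 'a::real_normed_field"
  assumes f: "f \<longlonglongrightarrow> F" and g: "g \<longlonglongrightarrow> G" and r: "norm G < r" "r < 1"
    and growth: "(\<lambda>n. r ^ n * norm (x n)) \<longlonglongrightarrow> 0"
    and rec: "\<forall>\<^sub>F n in sequentially. x n = f n + g n * x (Suc n)"
  shows "x \<longlonglongrightarrow> F / (1 - G)"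
proof -
  define X where "X = F / (1 - G)"
  have X: "X = F + G * X"
  proof -
    have "1 - G \<noteq> 0" using r by auto
    then show ?thesis by (simp add: X_def field_simps)
  qed
  have "0 < r" using r norm_ge_zero[of G] by linarith
  have "(\<lambda>n. norm (f n + g n * X - X)) \<longlonglongrightarrow> norm (F + G * X - X)"
    by (intro tendsto_intros f g)
  then have e: "(\<lambda>n. norm (f n + g n * X - X)) \<longlonglongrightarrow> 0" using X by simp
  have "\<forall>\<^sub>F n in sequentially. norm (g n) < r"
    using tendsto_norm[OF g] r(1) by (rule order_tendstoD(2))
  with rec have step: "\<forall>\<^sub>F n in sequentially. norm (x n - X)
      \<le> r * norm (x (Suc n) - X) + norm (f n + g n * X - X)"
  proof eventually_elim
    case (elim n)
    have "x n - X = g n * (x (Suc n) - X) + (f n + g n * X - X)"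
      using elim by (simp add: algebra_simps)
    then have "norm (x n - X) \<le> norm (g n) * norm (x (Suc n) - X) + norm (f n + g n * X - X)"
      by (metis norm_mult norm_triangle_ineq)
    also have "norm (g n) * norm (x (Suc n) - X) \<le> r * norm (x (Suc n) - X)"
      using elim by (intro mult_right_mono) auto
    finally show ?case by simp
  qed
  have "(\<lambda>n. r ^ n * norm (x n - X)) \<longlonglongrightarrow> 0"
  proof (rule tendsto_sandwich)
    show "\<forall>\<^sub>F n in sequentially. 0 \<le> r ^ n * norm (x n - X)" using \<open>0 < r\<close> by simp
    show "\<forall>\<^sub>F n in sequentially. r ^ n * norm (x n - X) \<le> r ^ n * norm (x n) + r ^ n * norm X"
      using \<open>0 < r\<close> norm_triangle_ineq4[of "x _" X]
      by (intro always_eventually allI) (simp flip: distrib_left)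
    have "(\<lambda>n. r ^ n * norm (x n) + r ^ n * norm X) \<longlonglongrightarrow> 0 + 0 * norm X"
      using r \<open>0 < r\<close> by (intro tendsto_intros growth LIMSEQ_realpow_zero) auto
    then show "(\<lambda>n. r ^ n * norm (x n) + r ^ n * norm X) \<longlonglongrightarrow> 0" by simp
  qed simp
  from tendsto_0_of_backward_contraction[OF \<open>0 < r\<close> r(2) _ e this step]
  show ?thesis by (simp add: tendsto_norm_zero_iff LIM_zero_iff X_def)
qed

section \<open>Backward orbits of contractions\<close>

text \<open>
  Run the maps backwards from the seed \<open>c\<close> at a far index \<open>n + k\<close>.  Moving the seed
  further out changes the value at \<open>n\<close> by at most \<open>q ^ k * \<rho>\<close>, since two points of the ball
  within distance \<open>\<rho>\<close> are contracted \<open>k\<close> times.  So the values converge as \<open>k\<close> grows,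
  and the limits form an orbit.
\<close>
lemma backward_orbit_of_contractions:
  fixes F :: "nat \<Rightarrow> 'a::complete_space \<Rightarrow> 'a"
  assumes q: "0 \<le> q" "q < 1" and \<rho>: "0 \<le> \<rho>"
    and maps: "\<And>n x. x \<in> cball c \<rho> \<Longrightarrow> F n x \<in> cball c \<rho>"
    and contr: "\<And>n x y. x \<in> cball c \<rho> \<Longrightarrow> y \<in> cball c \<rho> \<Longrightarrow> dist (F n x) (F n y) \<le> q * dist x y"
  obtains s where "\<And>n. s n \<in> cball c \<rho>" "\<And>n. s n = F n (s (Suc n))"
proof -
  \<comment> \<open>\<open>G k n\<close> is the value at index \<open>n\<close> when the seed is placed at index \<open>n + k\<close>.\<close>
  define G where "G = rec_nat (\<lambda>_. c) (\<lambda>_ g n. F n (g (Suc n)))"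
  have G0: "G 0 n = c" and GSuc: "G (Suc k) n = F n (G k (Suc n))" for k n
    by (simp_all add: G_def)
  have ball: "G k n \<in> cball c \<rho>" for k n
    by (induction k arbitrary: n) (auto simp: G0 GSuc \<rho> intro!: maps[unfolded mem_cball])
  have close: "dist (G (k + j) n) (G k n) \<le> q ^ k * \<rho>" for k j n
  proof (induction k arbitrary: n)
    case 0
    show ?case using ball[of j n] by (simp add: G0 dist_commute)
  next
    case (Suc k)
    have "dist (G (Suc k + j) n) (G (Suc k) n) \<le> q * dist (G (k + j) (Suc n)) (G k (Suc n))"
      by (simp add: GSuc contr ball del: mem_cball)
    also have "\<dots> \<le> q * (q ^ k * \<rho>)" by (intro mult_left_mono Suc q)
    finally show ?case by (simp add: mult.assoc)
  qed
  have "Cauchy (\<lambda>k. G k n)" for n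
  proof (rule metric_CauchyI)
    fix e :: real assume "0 < e"
    have "(\<lambda>k. q ^ k * \<rho>) \<longlonglongrightarrow> 0"
      using q by (intro tendsto_mult_left_zero LIMSEQ_realpow_zero)
    then obtain K where K: "q ^ K * \<rho> < e / 2"
      using order_tendstoD(2)[of _ 0 sequentially "e / 2"] \<open>0 < e\<close>
      by (auto simp: eventually_sequentially)
    have "dist (G m n) (G K n) < e / 2" if "m \<ge> K" for m
      using close[of K "m - K" n] that K by simp
    then show "\<exists>M. \<forall>m\<ge>M. \<forall>k\<ge>M. dist (G m n) (G k n) < e"
      by (meson dist_triangle_half_r dist_commute dist_triangle_half_l)
  qed
  then have "\<exists>l. (\<lambda>k. G k n) \<longlonglongrightarrow> l" for n
    by (simp add: Cauchy_convergent_iff convergent_def)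
  then obtain s where s: "\<And>n. (\<lambda>k. G k n) \<longlonglongrightarrow> s n" by metis
  have s_ball: "s n \<in> cball c \<rho>" for n
    using closed_sequentially[OF closed_cball _ s] ball by blast
  have "s n = F n (s (Suc n))" for n
  proof (rule LIMSEQ_unique)
    show "(\<lambda>k. G (Suc k) n) \<longlonglongrightarrow> s n" by (rule LIMSEQ_Suc[OF s])
    have "dist (G (Suc k) n) (F n (s (Suc n))) \<le> dist (G k (Suc n)) (s (Suc n))" for k
    proof -
      have "dist (G (Suc k) n) (F n (s (Suc n))) \<le> q * dist (G k (Suc n)) (s (Suc n))"
        unfolding GSuc by (intro contr ball s_ball)
      also have "\<dots> \<le> 1 * dist (G k (Suc n)) (s (Suc n))"
        using q by (intro mult_right_mono) auto
      finally show ?thesis by simp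
    qed
    then show "(\<lambda>k. G (Suc k) n) \<longlonglongrightarrow> F n (s (Suc n))"
      by (intro metric_tendsto_imp_tendsto[OF s] always_eventually allI)
  qed
  from that[OF s_ball this] show thesis .
qed

section \<open>Square summable vectors\<close>

lemma ell2_iff: "x \<in> ell2 \<longleftrightarrow> x 0 = 0 \<and> summable (\<lambda>n. (cmod (x n))\<^sup>2)"
proof (cases "x 0 = 0")
  case True
  then have "(\<lambda>n. (cmod (x n))\<^sup>2) summable_on {1..} \<longleftrightarrow> (\<lambda>n. (cmod (x n))\<^sup>2) summable_on UNIV"
    by (intro summable_on_cong_neutral) (auto simp: not_le)
  also have "\<dots> \<longleftrightarrow> summable (\<lambda>n. (cmod (x n))\<^sup>2)"
    by (rule summable_on_UNIV_nonneg_real_iff) simp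
  finally show ?thesis using True by (simp add: ell2_def)
qed (simp add: ell2_def)

lemma ell2_tendsto_0:
  assumes "x \<in> ell2"
  shows "x \<longlonglongrightarrow> 0"
proof -
  have "(\<lambda>n. sqrt ((cmod (x n))\<^sup>2)) \<longlonglongrightarrow> sqrt 0"
    using assms by (intro tendsto_real_sqrt summable_LIMSEQ_zero) (simp add: ell2_iff)
  then show ?thesis by (simp add: tendsto_norm_zero_iff)
qed

lemma ell2_diff:
  assumes "x \<in> ell2" "y \<in> ell2"
  shows "(\<lambda>n. x n - y n) \<in> ell2"
proof -
  have "summable (\<lambda>n. 2 * (cmod (x n))\<^sup>2 + 2 * (cmod (y n))\<^sup>2)"
    using assms by (intro summable_add summable_mult) (auto simp: ell2_iff)
  moreover have "(cmod (x n - y n))\<^sup>2 \<le> 2 * (cmod (x n))\<^sup>2 + 2 * (cmod (y n))\<^sup>2" for n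
  proof -
    have "(cmod (x n - y n))\<^sup>2 \<le> (cmod (x n) + cmod (y n))\<^sup>2"
      by (intro power_mono norm_triangle_ineq4) simp
    also have "\<dots> \<le> 2 * (cmod (x n))\<^sup>2 + 2 * (cmod (y n))\<^sup>2"
      using sum_squares_bound[of "cmod (x n)" "cmod (y n)"] by (simp add: power2_sum)
    finally show ?thesis .
  qed
  ultimately show ?thesis
    using assms by (auto simp: ell2_iff intro: summable_comparison_test')
qed

lemma ell2_scale: "x \<in> ell2 \<Longrightarrow> (\<lambda>n. c * x n) \<in> ell2"
  by (auto simp: ell2_iff norm_mult power_mult_distrib intro: summable_mult)

section \<open>The Wronskian and uniqueness of the Weyl solution\<close>

text \<open>
  The recurrences for \<open>x\<close> and \<open>w\<close> differ only in the first equation, where \<open>w\<close> has the source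
  term 1; hence the Wronskian is constant and equals its value at the first index.
\<close>
lemma wronskian_constant:
  assumes x0: "x 0 = 0" and w0: "w 0 = 0"
    and x: "jacobi_op a b x = (\<lambda>n. l * x n)"
    and w: "(\<lambda>n. l * w n - jacobi_op a b w n) = delta 1"
  shows "of_real (a (Suc n)) * (x (Suc (Suc n)) * w (Suc n) - x (Suc n) * w (Suc (Suc n))) = x 1"
proof (induction n)
  case 0
  have X: "of_real (a 1) * x 2 = (l - of_real (b 1)) * x 1"
    using fun_cong[OF x, of 1] x0 by (simp add: jacobi_op_apply algebra_simps numeral_2_eq_2)
  have W: "of_real (a 1) * w 2 = (l - of_real (b 1)) * w 1 - 1"
    using fun_cong[OF w, of 1] w0 by (simp add: jacobi_op_apply delta_def algebra_simps numeral_2_eq_2)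
  have "of_real (a 1) * (x 2 * w 1 - x 1 * w 2)
      = (of_real (a 1) * x 2) * w 1 - x 1 * (of_real (a 1) * w 2)" by (simp add: algebra_simps)
  also have "\<dots> = x 1" unfolding X W by (simp add: algebra_simps)
  finally show ?case by (simp add: numeral_2_eq_2)
next
  case (Suc n)
  let ?m = "Suc (Suc n)"
  have X: "of_real (a ?m) * x (Suc ?m) = (l - of_real (b ?m)) * x ?m - of_real (a (Suc n)) * x (Suc n)"
    using fun_cong[OF x, of ?m] x0 by (simp add: jacobi_op_apply algebra_simps)
  have W: "of_real (a ?m) * w (Suc ?m) = (l - of_real (b ?m)) * w ?m - of_real (a (Suc n)) * w (Suc n)"
    using fun_cong[OF w, of ?m] w0 by (simp add: jacobi_op_apply delta_def algebra_simps)
  have "of_real (a ?m) * (x (Suc ?m) * w ?m - x ?m * w (Suc ?m))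
      = (of_real (a ?m) * x (Suc ?m)) * w ?m - x ?m * (of_real (a ?m) * w (Suc ?m))"
    by (simp add: algebra_simps)
  also have "\<dots> = of_real (a (Suc n)) * (x ?m * w (Suc n) - x (Suc n) * w ?m)"
    unfolding X W by (simp add: algebra_simps)
  also have "\<dots> = x 1" by (rule Suc)
  finally show ?case .
qed

text \<open>
  For two square summable vectors the Wronskian tends to 0, and being constant it is 0.  But it
  equals \<open>x 1\<close>, and a solution of the three-term recurrence with \<open>x 0 = x 1 = 0\<close> vanishes.
\<close>
lemma green_vector_imp_no_eigenvector:
  assumes a_pos: "\<And>n. n \<ge> 1 \<Longrightarrow> a n > 0" and a: "Bseq a"
    and w2: "w \<in> ell2" and w: "(\<lambda>n. l * w n - jacobi_op a b w n) = delta 1"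
    and x2: "x \<in> ell2" and x: "jacobi_op a b x = (\<lambda>n. l * x n)"
  shows "x = (\<lambda>_. 0)"
proof -
  have x0: "x 0 = 0" and w0: "w 0 = 0" using x2 w2 by (auto simp: ell2_iff)
  obtain M where M: "\<And>n. \<bar>a n\<bar> \<le> M" using a by (auto simp: Bseq_def)
  let ?W = "\<lambda>n. x (Suc (Suc n)) * w (Suc n) - x (Suc n) * w (Suc (Suc n))"
  have "?W \<longlonglongrightarrow> 0 * 0 - 0 * 0"
    by (intro tendsto_intros ell2_tendsto_0[OF x2, THEN LIMSEQ_Suc, THEN LIMSEQ_Suc]
      ell2_tendsto_0[OF w2, THEN LIMSEQ_Suc, THEN LIMSEQ_Suc]
      ell2_tendsto_0[OF x2, THEN LIMSEQ_Suc] ell2_tendsto_0[OF w2, THEN LIMSEQ_Suc])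
  then have "(\<lambda>n. M * cmod (?W n)) \<longlonglongrightarrow> M * 0"
    by (intro tendsto_mult tendsto_const) (simp add: tendsto_norm_zero)
  moreover have "cmod (x 1) \<le> M * cmod (?W n)" for n
  proof -
    have "cmod (x 1) = \<bar>a (Suc n)\<bar> * cmod (?W n)"
      unfolding wronskian_constant[OF x0 w0 x w, of n, symmetric] by (simp add: norm_mult)
    also have "\<dots> \<le> M * cmod (?W n)" by (intro mult_right_mono M) simp
    finally show ?thesis .
  qed
  ultimately have "cmod (x 1) \<le> M * 0" by (intro LIMSEQ_le_const) auto
  then have x1: "x 1 = 0" by simp
  have "x n = 0 \<and> x (Suc n) = 0" for n
  proof (induction n)
    case (Suc n)
    have "of_real (a (Suc n)) * x (Suc (Suc n)) = 0"
      using fun_cong[OF x, of "Suc n"] x0 Suc by (simp add: jacobi_op_apply)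
    then show ?case using Suc a_pos[of "Suc n"] by simp
  qed (use x0 x1 in auto)
  then show ?thesis by auto
qed

text \<open>
  The resolvent is an inverse function defined by description, so that its value at
  \<open>\<delta>\<^sub>1\<close> is known as soon as one preimage in \<open>\<ell>\<^sup>2\<close> is exhibited and shown to be unique.
  Uniqueness comes from the existence of this very preimage.
\<close>
lemma weyl_eq_green_vector:
  assumes a_pos: "\<And>n. n \<ge> 1 \<Longrightarrow> a n > 0" and a: "Bseq a"
    and w2: "w \<in> ell2"
    and w: "(\<lambda>n. (z + inverse z) * w n - jacobi_op a b w n) = delta 1"
  shows "weyl a b n z = w n"
proof -
  let ?l = "z + inverse z"
  have "v = w" if v2: "v \<in> ell2" and v: "(\<lambda>n. ?l * v n - jacobi_op a b v n) = delta 1" for v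
  proof -
    let ?d = "\<lambda>n. v n - w n"
    have d2: "?d \<in> ell2" by (intro ell2_diff v2 w2)
    have "jacobi_op a b ?d n = ?l * ?d n" for n
    proof (cases "n = 0")
      case False
      have "jacobi_op a b ?d n = jacobi_op a b v n - jacobi_op a b w n"
        using False v2 w2 by (simp add: jacobi_op_apply ell2_iff algebra_simps)
      also have "\<dots> = ?l * ?d n"
        using fun_cong[OF v, of n] fun_cong[OF w, of n] by (simp add: algebra_simps)
      finally show ?thesis .
    qed (use v2 w2 in \<open>simp add: jacobi_op_def ell2_iff\<close>)
    then have "?d = (\<lambda>_. 0)"
      using green_vector_imp_no_eigenvector[OF a_pos a w2 w d2] by blast
    then show ?thesis by (auto simp: fun_eq_iff)
  qed
  then have res: "jacobi_resolvent a b ?l (delta 1) = w"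
    unfolding jacobi_resolvent_def the_inv_into_def using w2 w
    by (intro the_equality conjI; blast)
  show ?thesis
  proof (cases "n = 0")
    case True
    then show ?thesis using w2 by (simp add: weyl_def ell2_inner_def delta_def ell2_iff)
  next
    case False
    have "infsum (\<lambda>m. cnj (delta n m) * w m) {1..} = infsum (\<lambda>m. w m) {n}"
      by (rule infsum_cong_neutral) (use False in \<open>auto simp: delta_def\<close>)
    then show ?thesis unfolding weyl_def ell2_inner_def res by simp
  qed
qed

section \<open>Decaying solutions from the Riccati equation\<close>

text \<open>
  A solution \<open>w\<close> of the eigenvalue equation gives the ratios
  \<open>t n = w (n + 1) / (z * a n * w n)\<close>, for which the equation becomes the Riccati equation
  below.  For the free matrix, \<open>a = 1\<close> and \<open>b = 0\<close>, its decaying solution \<open>w n = z ^ n\<close>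
  corresponds to \<open>t = 1\<close>.  Solved for \<open>t n\<close>, the equation is a backward recursion by
  fractional linear maps.  The hypothesis \<open>small\<close> says that these preserve the ball of radius \<open>\<rho>\<close> about 1,
  where their denominators are at least \<open>1 / (1 + \<rho>)\<close> in modulus; \<open>contr\<close> bounds their
  Lipschitz constants there.
\<close>
lemma riccati_solution:
  fixes a b :: "nat \<Rightarrow> real" and z :: complex
  assumes \<rho>: "0 \<le> \<rho>" and q: "q < 1"
    and small: "\<And>n. n > N \<Longrightarrow>
      cmod z * \<bar>b n\<bar> + (cmod z)\<^sup>2 * (\<bar>(a n)\<^sup>2 - 1\<bar> * (1 + \<rho>) + \<rho>) \<le> \<rho> / (1 + \<rho>)"
    and contr: "\<And>n. n > N \<Longrightarrow> (cmod z * a n * (1 + \<rho>))\<^sup>2 \<le> q"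
  obtains t where "\<And>n. cmod (t n - 1) \<le> \<rho>" "\<And>n. t n \<noteq> 0"
    "\<And>n. n \<ge> N \<Longrightarrow>
      t n * (1 + z\<^sup>2 - z * of_real (b (Suc n)) - z\<^sup>2 * (of_real (a (Suc n)))\<^sup>2 * t (Suc n)) = 1"
proof -
  define D where "D = (\<lambda>n t. 1 + z\<^sup>2 - z * of_real (b (Suc (N + n)))
    - z\<^sup>2 * (of_real (a (Suc (N + n))))\<^sup>2 * t)"
  have D1: "cmod (1 - D n t) \<le> \<rho> / (1 + \<rho>)" if t: "cmod (t - 1) \<le> \<rho>" for n t
  proof -
    let ?a = "a (Suc (N + n))" and ?b = "b (Suc (N + n))"
    have "cmod t \<le> 1 + \<rho>" using norm_triangle_sub[of t 1] t by simp
    have "1 - D n t = z * of_real ?b + z\<^sup>2 * (of_real (?a\<^sup>2 - 1) * t + (t - 1))"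
      by (simp add: D_def algebra_simps)
    also have "cmod \<dots> \<le> cmod z * \<bar>?b\<bar> + (cmod z)\<^sup>2 * cmod (of_real (?a\<^sup>2 - 1) * t + (t - 1))"
      by (rule norm_triangle_le) (simp add: norm_mult norm_power)
    also have "cmod (of_real (?a\<^sup>2 - 1) * t + (t - 1)) \<le> \<bar>?a\<^sup>2 - 1\<bar> * cmod t + cmod (t - 1)"
      by (rule norm_triangle_le) (simp add: norm_mult del: of_real_diff)
    also have "\<dots> \<le> \<bar>?a\<^sup>2 - 1\<bar> * (1 + \<rho>) + \<rho>"
      using \<open>cmod t \<le> 1 + \<rho>\<close> t by (intro add_mono mult_left_mono) auto
    also have "cmod z * \<bar>?b\<bar> + (cmod z)\<^sup>2 * (\<bar>?a\<^sup>2 - 1\<bar> * (1 + \<rho>) + \<rho>) \<le> \<rho> / (1 + \<rho>)"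
      by (rule small) simp
    finally show ?thesis by (simp add: mult_left_mono)
  qed
  have D2: "cmod (D n t) \<ge> 1 / (1 + \<rho>)" if t: "cmod (t - 1) \<le> \<rho>" for n t
  proof -
    have "1 / (1 + \<rho>) = 1 - \<rho> / (1 + \<rho>)" using \<rho> by (simp add: field_simps)
    also have "\<dots> \<le> cmod (D n t)"
      using D1[OF t, of n] norm_triangle_ineq3[of 1 "D n t"] by (simp add: norm_minus_commute)
    finally show ?thesis .
  qed
  have D0: "D n t \<noteq> 0" if "cmod (t - 1) \<le> \<rho>" for n t
    using D2[OF that, of n] \<rho> by (auto simp: field_simps)
  have inv: "cmod (inverse (D n t)) \<le> 1 + \<rho>" if "cmod (t - 1) \<le> \<rho>" for n t
    using D2[OF that, of n] D0[OF that, of n] \<rho>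
    by (simp add: norm_inverse norm_divide field_simps)
  obtain s where s: "\<And>n. s n \<in> cball 1 \<rho>" "\<And>n. s n = inverse (D n (s (Suc n)))"
  proof (rule backward_orbit_of_contractions[where c = 1 and \<rho> = \<rho> and q = q and F = "\<lambda>n t. inverse (D n t)"])
    show "0 \<le> q" using contr[of "Suc N"] zero_le_power2 order_trans by blast
    fix n t assume "t \<in> cball (1::complex) \<rho>"
    then have t: "cmod (t - 1) \<le> \<rho>" by (simp add: dist_norm norm_minus_commute)
    have "1 - inverse (D n t) = - (1 - D n t) * inverse (D n t)"
      using D0[OF t] by (simp add: field_simps)
    then have "cmod (1 - inverse (D n t)) = cmod (1 - D n t) * cmod (inverse (D n t))"
      by (simp only: norm_mult norm_minus_cancel)
    also have "\<dots> \<le> \<rho> / (1 + \<rho>) * (1 + \<rho>)"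
      using \<rho> by (intro mult_mono D1 inv t) auto
    also have "\<dots> = \<rho>" using \<rho> by simp
    finally show "inverse (D n t) \<in> cball 1 \<rho>" by (simp add: dist_norm)
    fix t' assume "t' \<in> cball (1::complex) \<rho>"
    then have t': "cmod (t' - 1) \<le> \<rho>" by (simp add: dist_norm norm_minus_commute)
    let ?a = "a (Suc (N + n))"
    have "inverse (D n t) - inverse (D n t')
        = inverse (D n t) * (D n t' - D n t) * inverse (D n t')"
      using D0[OF t] D0[OF t'] by (rule inverse_diff_inverse[THEN trans]) (simp add: algebra_simps)
    also have "D n t' - D n t = (z * of_real ?a)\<^sup>2 * (t - t')"
      by (simp add: D_def algebra_simps power_mult_distrib)
    finally have "dist (inverse (D n t)) (inverse (D n t'))
        = cmod (inverse (D n t)) * ((cmod z * ?a)\<^sup>2 * dist t t') * cmod (inverse (D n t'))"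
      by (simp add: dist_norm norm_mult norm_power power_mult_distrib)
    also have "\<dots> \<le> (1 + \<rho>) * ((cmod z * ?a)\<^sup>2 * dist t t') * (1 + \<rho>)"
      using \<rho> by (intro mult_mono inv t t') auto
    also have "\<dots> = (cmod z * ?a * (1 + \<rho>))\<^sup>2 * dist t t'"
      by (simp add: power2_eq_square algebra_simps)
    also have "\<dots> \<le> q * dist t t'" by (intro mult_right_mono contr) auto
    finally show "dist (inverse (D n t)) (inverse (D n t')) \<le> q * dist t t'" .
  qed (rule q \<rho> | blast)+
  have ball: "cmod (s n - 1) \<le> \<rho>" for n
    using s(1)[of n] by (simp add: dist_norm norm_minus_commute)
  have sD: "s n * D n (s (Suc n)) = 1" for n
    using s(2)[of n] D0[OF ball, of n "Suc n"] by (metis left_inverse)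
  then have "s n \<noteq> 0" for n by (metis mult_zero_left zero_neq_one)
  \<comment> \<open>Below \<open>N\<close> the truncated difference gives the value \<open>s 0\<close>, so \<open>t\<close> is near 1 and nonzero
      everywhere.\<close>
  moreover have "s (n - N) * (1 + z\<^sup>2 - z * of_real (b (Suc n))
      - z\<^sup>2 * (of_real (a (Suc n)))\<^sup>2 * s (Suc n - N)) = 1" if "n \<ge> N" for n
    using sD[of "n - N"] that by (simp add: D_def Suc_diff_le)
  ultimately show thesis using that[of "\<lambda>n. s (n - N)"] ball by blast
qed

text \<open>
  The vector recovered from its Riccati ratios \<open>t n\<close>, where \<open>n \<ge> 1\<close>; the value \<open>t 0\<close> is a
  constant factor.
\<close>
definition weyl_product :: "(nat \<Rightarrow> real) \<Rightarrow> (nat \<Rightarrow> complex) \<Rightarrow> complex \<Rightarrow> nat \<Rightarrow> complex" where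
  "weyl_product a t z n =
     (if n = 0 then 0 else z ^ n * (\<Prod>k<n. t k) * of_real (\<Prod>k=1..<n. a k))"

lemma weyl_product_Suc:
  "n \<ge> 1 \<Longrightarrow> weyl_product a t z (Suc n) = z * of_real (a n) * t n * weyl_product a t z n"
  by (simp add: weyl_product_def prod.atLeastLessThan_Suc)

text \<open>
  The squared moduli of the ratios are at most \<open>q < 1\<close>, whence the ratio test.
\<close>
lemma weyl_product_in_ell2:
  assumes "q < 1" and t: "\<And>n. cmod (t n - 1) \<le> \<rho>" and a_pos: "\<And>n. n \<ge> 1 \<Longrightarrow> a n > 0"
    and contr: "\<And>n. n > N \<Longrightarrow> (cmod z * a n * (1 + \<rho>))\<^sup>2 \<le> q"
  shows "weyl_product a t z \<in> ell2"
  unfolding ell2_iff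
proof
  show "summable (\<lambda>n. (cmod (weyl_product a t z n))\<^sup>2)"
  proof (rule summable_ratio_test[OF \<open>q < 1\<close>])
    fix n assume n: "Suc N \<le> n"
    have "cmod (t n) \<le> 1 + \<rho>" using norm_triangle_sub[of "t n" 1] t[of n] by simp
    then have "cmod z * a n * cmod (t n) \<le> cmod z * a n * (1 + \<rho>)"
      using a_pos[of n] n by (intro mult_left_mono) auto
    then have "(cmod z * a n * cmod (t n))\<^sup>2 \<le> (cmod z * a n * (1 + \<rho>))\<^sup>2"
      using a_pos[of n] n by (intro power_mono) auto
    also have "\<dots> \<le> q" using contr n by simp
    finally have "(cmod z * a n * cmod (t n))\<^sup>2 \<le> q" .
    then have "(cmod z * a n * cmod (t n))\<^sup>2 * (cmod (weyl_product a t z n))\<^sup>2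
        \<le> q * (cmod (weyl_product a t z n))\<^sup>2"
      by (rule mult_right_mono) simp
    then show "norm ((cmod (weyl_product a t z (Suc n)))\<^sup>2)
        \<le> q * norm ((cmod (weyl_product a t z n))\<^sup>2)"
      using n by (simp add: weyl_product_Suc norm_mult power_mult_distrib)
  qed
qed (simp add: weyl_product_def)

text \<open>
  This is the Riccati equation multiplied out.  The factor \<open>t 0\<close> in the product is chosen so
  that for \<open>N = 0\<close> the equation at index 1 comes out with the right-hand side 1.
\<close>
lemma weyl_product_recurrence:
  assumes "z \<noteq> 0" and n: "n > N"
    and riccati: "\<And>n. n \<ge> N \<Longrightarrow>
      t n * (1 + z\<^sup>2 - z * of_real (b (Suc n)) - z\<^sup>2 * (of_real (a (Suc n)))\<^sup>2 * t (Suc n)) = 1"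
  shows "(z + inverse z) * weyl_product a t z n - jacobi_op a b (weyl_product a t z) n = delta 1 n"
proof -
  let ?w = "weyl_product a t z"
  obtain m where m: "n = Suc m" "m \<ge> N" using n by (cases n) auto
  have w0: "?w 0 = 0" by (simp add: weyl_product_def)
  let ?R = "1 + z\<^sup>2 - z * of_real (b n) - z\<^sup>2 * (of_real (a n))\<^sup>2 * t n"
  have "(z + inverse z) * ?w n - jacobi_op a b ?w n
      = (z + inverse z - of_real (b n) - z * (of_real (a n))\<^sup>2 * t n) * ?w n - of_real (a m) * ?w m"
  proof -
    have "jacobi_op a b ?w n = of_real (a n) * ?w (Suc n) + of_real (b n) * ?w n + of_real (a m) * ?w m"
      using m by (simp add: jacobi_op_apply w0)
    moreover have "?w (Suc n) = z * of_real (a n) * t n * ?w n"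
      using n by (simp add: weyl_product_Suc)
    ultimately show ?thesis by (simp add: power2_eq_square algebra_simps)
  qed
  also have "z + inverse z - of_real (b n) - z * (of_real (a n))\<^sup>2 * t n = inverse z * ?R"
    using \<open>z \<noteq> 0\<close> by (simp add: field_simps power2_eq_square)
  also have "inverse z * ?R * ?w n - of_real (a m) * ?w m = delta 1 n"
  proof (cases "m = 0")
    case True
    have "inverse z * ?R * ?w n = t m * ?R"
      using \<open>z \<noteq> 0\<close> True m by (simp add: weyl_product_def)
    also have "\<dots> = 1" using riccati[OF m(2)] m by simp
    finally show ?thesis using True m w0 by (simp add: delta_def)
  next
    case False
    then have "inverse z * ?R * ?w n = t m * ?R * (of_real (a m) * ?w m)"
      using \<open>z \<noteq> 0\<close> m by (simp add: weyl_product_Suc)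
    also have "t m * ?R = 1" using riccati[OF m(2)] m by simp
    finally show ?thesis using False m by (simp add: delta_def)
  qed
  finally show ?thesis .
qed

section \<open>Existence of the Weyl solution\<close>

text \<open>
  The equation with index \<open>n\<close> determines the entry with index \<open>n - 1\<close>, because the
  off-diagonal coefficient \<open>a (n - 1)\<close> does not vanish.
\<close>
lemma extend_solution_backwards:
  assumes a_pos: "\<And>n. n \<ge> 1 \<Longrightarrow> a n > 0" and "x \<in> ell2"
    and "\<And>n. n > Suc N \<Longrightarrow> l * x n - jacobi_op a b x n = 0"
  shows "\<exists>y\<in>ell2. (\<forall>n>N. y n = x n) \<and> (\<forall>n>1. l * y n - jacobi_op a b y n = 0)"
  using assms(2,3)
proof (induction N arbitrary: x)
  case 0
  then show ?case by auto
next
  case (Suc N)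
  let ?m = "Suc (Suc N)"
  define v where "v = ((l - of_real (b ?m)) * x ?m - of_real (a ?m) * x (Suc ?m)) / of_real (a (Suc N))"
  define x' where "x' = x(Suc N := v)"
  have x'0: "x' 0 = 0" and x0: "x 0 = 0" using Suc.prems by (auto simp: x'_def ell2_iff)
  have "summable (\<lambda>n. (cmod (x' n))\<^sup>2) \<longleftrightarrow> summable (\<lambda>n. (cmod (x n))\<^sup>2)"
    by (rule summable_cong, rule eventually_sequentiallyI[of ?m]) (auto simp: x'_def)
  then have "x' \<in> ell2" using Suc.prems x'0 by (simp add: ell2_iff)
  moreover have "l * x' n - jacobi_op a b x' n = 0" if n: "n > Suc N" for n
  proof (cases "n = ?m")
    case True
    have "of_real (a (Suc N)) * v = (l - of_real (b ?m)) * x ?m - of_real (a ?m) * x (Suc ?m)"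
      using a_pos[of "Suc N"] by (simp add: v_def)
    then show ?thesis using True x'0 by (simp add: jacobi_op_apply x'_def algebra_simps)
  next
    case False
    then have "l * x n - jacobi_op a b x n = 0" using n by (intro Suc.prems) auto
    moreover have "n - Suc 0 \<noteq> Suc N" using False n by auto
    ultimately show ?thesis using n x0 x'0 by (simp add: jacobi_op_apply x'_def)
  qed
  ultimately obtain y where "y \<in> ell2" "\<forall>n>N. y n = x' n"
      "\<forall>n>1. l * y n - jacobi_op a b y n = 0"
    using Suc.IH by blast
  then show ?case by (intro bexI[of _ y]) (auto simp: x'_def)
qed

text \<open>
  Far out the matrix is close to the free one, so that the Riccati equation has a solution there
  and yields a decaying solution of the eigenvalue equation.  Extended backwards to all indices,
  it satisfies every equation except possibly the first.  It would be an eigenvector if it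
  satisfied that one too; so the defect there is not 0, and dividing by it gives the vector
  sought.
\<close>
lemma green_vector_exists:
  fixes a b :: "nat \<Rightarrow> real" and z :: complex
  assumes a_pos: "\<And>n. n \<ge> 1 \<Longrightarrow> a n > 0" and a_lim: "a \<longlonglongrightarrow> 1" and b_lim: "b \<longlonglongrightarrow> 0"
    and z: "cmod z < 1" "z \<noteq> 0" and not_ev: "\<not> jacobi_eigenvalue a b (z + inverse z)"
  obtains w where "w \<in> ell2" "(\<lambda>n. (z + inverse z) * w n - jacobi_op a b w n) = delta 1"
proof -
  let ?l = "z + inverse z"
  have z2: "(cmod z)\<^sup>2 < 1" using z by (simp add: power_less_one_iff)
  \<comment> \<open>In the free limit the two conditions on the radius read
      \<open>(cmod z)\<^sup>2 * \<rho> < \<rho> / (1 + \<rho>)\<close> and \<open>(cmod z * (1 + \<rho>))\<^sup>2 < q\<close>; the second, with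
      \<open>q < 1\<close>, implies the first.\<close>
  have "((\<lambda>\<rho>. (cmod z * (1 + \<rho>))\<^sup>2) \<longlongrightarrow> (cmod z * (1 + 0))\<^sup>2) (at_right 0)"
    by (intro tendsto_intros)
  then have "\<forall>\<^sub>F \<rho> in at_right 0. (cmod z * (1 + \<rho>))\<^sup>2 < 1"
    by (rule order_tendstoD(2)) (use z2 in simp)
  with eventually_at_right_less[of 0] have "\<forall>\<^sub>F \<rho> in at_right 0. 0 < \<rho> \<and> (cmod z * (1 + \<rho>))\<^sup>2 < 1"
    by eventually_elim simp
  then obtain \<rho> where \<rho>: "0 < \<rho>" "(cmod z * (1 + \<rho>))\<^sup>2 < 1"
    using eventually_happens trivial_limit_at_right_real by blast
  obtain q where q: "(cmod z * (1 + \<rho>))\<^sup>2 < q" "q < 1" using dense[OF \<rho>(2)] by blast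
  have "(cmod z)\<^sup>2 * (1 + \<rho>) \<le> (cmod z)\<^sup>2 * (1 + \<rho>)\<^sup>2"
    using \<rho>(1) by (intro mult_left_mono) (auto simp: power2_eq_square)
  also have "\<dots> < 1" using \<rho>(2) by (simp add: power_mult_distrib)
  finally have "\<rho> * ((cmod z)\<^sup>2 * (1 + \<rho>)) < \<rho> * 1"
    using \<rho>(1) by (intro mult_strict_left_mono)
  then have "(cmod z)\<^sup>2 * \<rho> < \<rho> / (1 + \<rho>)"
    using \<rho>(1) by (simp add: pos_less_divide_eq mult_ac)
  moreover have "(\<lambda>n. cmod z * \<bar>b n\<bar> + (cmod z)\<^sup>2 * (\<bar>(a n)\<^sup>2 - 1\<bar> * (1 + \<rho>) + \<rho>))
      \<longlonglongrightarrow> cmod z * \<bar>0\<bar> + (cmod z)\<^sup>2 * (\<bar>1\<^sup>2 - 1\<bar> * (1 + \<rho>) + \<rho>)"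
    by (intro tendsto_intros a_lim b_lim)
  ultimately have ev1: "\<forall>\<^sub>F n in sequentially.
      cmod z * \<bar>b n\<bar> + (cmod z)\<^sup>2 * (\<bar>(a n)\<^sup>2 - 1\<bar> * (1 + \<rho>) + \<rho>) < \<rho> / (1 + \<rho>)"
    by (intro order_tendstoD(2)) auto
  have "(\<lambda>n. (cmod z * a n * (1 + \<rho>))\<^sup>2) \<longlonglongrightarrow> (cmod z * 1 * (1 + \<rho>))\<^sup>2"
    by (intro tendsto_intros a_lim)
  then have "\<forall>\<^sub>F n in sequentially. (cmod z * a n * (1 + \<rho>))\<^sup>2 < q"
    by (rule order_tendstoD(2)) (use q in simp)
  with ev1 have "\<forall>\<^sub>F n in sequentially.
      cmod z * \<bar>b n\<bar> + (cmod z)\<^sup>2 * (\<bar>(a n)\<^sup>2 - 1\<bar> * (1 + \<rho>) + \<rho>) \<le> \<rho> / (1 + \<rho>)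
      \<and> (cmod z * a n * (1 + \<rho>))\<^sup>2 \<le> q"
    by eventually_elim simp
  then obtain N where N: "\<And>n. n > N \<Longrightarrow>
      cmod z * \<bar>b n\<bar> + (cmod z)\<^sup>2 * (\<bar>(a n)\<^sup>2 - 1\<bar> * (1 + \<rho>) + \<rho>) \<le> \<rho> / (1 + \<rho>)"
      "\<And>n. n > N \<Longrightarrow> (cmod z * a n * (1 + \<rho>))\<^sup>2 \<le> q"
    unfolding eventually_sequentially by (meson less_imp_le)
  obtain t where t: "\<And>n. cmod (t n - 1) \<le> \<rho>" "\<And>n. t n \<noteq> 0"
    "\<And>n. n \<ge> N \<Longrightarrow>
      t n * (1 + z\<^sup>2 - z * of_real (b (Suc n)) - z\<^sup>2 * (of_real (a (Suc n)))\<^sup>2 * t (Suc n)) = 1"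
    using riccati_solution[where N = N and z = z and a = a and b = b, OF less_imp_le[OF \<rho>(1)] q(2) N]
    by blast
  let ?x = "weyl_product a t z"
  have "?x \<in> ell2" by (rule weyl_product_in_ell2[OF q(2) t(1) a_pos N(2)])
  moreover have "?l * ?x n - jacobi_op a b ?x n = 0" if "n > Suc N" for n
    using weyl_product_recurrence[where N = N and t = t and a = a and b = b, OF z(2) _ t(3), of n] that by (simp add: delta_def)
  ultimately obtain y where y: "y \<in> ell2" "\<And>n. n > N \<Longrightarrow> y n = ?x n"
      "\<And>n. n > 1 \<Longrightarrow> ?l * y n - jacobi_op a b y n = 0"
    using extend_solution_backwards[where a = a and b = b and l = ?l and x = ?x and N = N, OF a_pos]
    by blast
  have y0: "y 0 = 0" using y(1) by (simp add: ell2_iff)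
  define v where "v = ?l * y 1 - jacobi_op a b y 1"
  have y_eq: "?l * y n - jacobi_op a b y n = v * delta 1 n" for n
    using y(3)[of n] y0 by (cases "n = 0 \<or> n = 1") (auto simp: v_def delta_def jacobi_op_def)
  have "?x (Suc N) \<noteq> 0"
  proof -
    have "a k \<noteq> 0" if "k \<ge> 1" for k using a_pos[OF that] by simp
    then show ?thesis using z(2) t(2) by (auto simp: weyl_product_def)
  qed
  then have y_nonzero: "y \<noteq> (\<lambda>_. 0)" using y(2)[of "Suc N"] by auto
  have "v \<noteq> 0"
  proof
    assume "v = 0"
    then have "jacobi_op a b y = (\<lambda>n. ?l * y n)" using y_eq by (auto simp: fun_eq_iff)
    then show False using not_ev y(1) y_nonzero by (auto simp: jacobi_eigenvalue_def)
  qed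
  let ?w = "\<lambda>n. inverse v * y n"
  have w: "?w \<in> ell2" by (rule ell2_scale[OF y(1)])
  have "?l * ?w n - jacobi_op a b ?w n = delta 1 n" for n
  proof -
    have "jacobi_op a b ?w n = inverse v * jacobi_op a b y n"
    proof (cases "n = 0")
      case True
      then show ?thesis by (simp add: jacobi_op_def)
    next
      case False
      then show ?thesis using y0 by (simp add: jacobi_op_apply algebra_simps)
    qed
    then have "?l * ?w n - jacobi_op a b ?w n = inverse v * (?l * y n - jacobi_op a b y n)"
      by (simp add: algebra_simps)
    then show ?thesis using y_eq[of n] \<open>v \<noteq> 0\<close> by simp
  qed
  then show thesis using that[OF w] by blast
qed

section \<open>Orthogonal polynomials as a formal eigenvector\<close>

definition orth_value :: "(nat \<Rightarrow> real) \<Rightarrow> (nat \<Rightarrow> real) \<Rightarrow> nat \<Rightarrow> complex \<Rightarrow> complex" where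
  "orth_value a b n x = poly (map_poly complex_of_real (orth_poly a b n)) x"

lemma orth_value_0: "orth_value a b 0 x = 1"
  by (simp add: orth_value_def)

lemma orth_value_recurrence:
  assumes "\<And>n. n \<ge> 1 \<Longrightarrow> a n > 0"
  shows "x * orth_value a b n x =
           of_real (a (Suc n)) * orth_value a b (Suc n) x + of_real (b (Suc n)) * orth_value a b n x
           + (if n = 0 then 0 else of_real (a n) * orth_value a b (n - 1) x)"
proof -
  define ev where "ev = (\<lambda>p. poly (map_poly complex_of_real p) x)"
  have ev_add: "ev (p + q) = ev p + ev q" for p q
  proof -
    have "map_poly complex_of_real (p + q) = map_poly of_real p + map_poly of_real q"
      by (rule poly_eqI) (simp add: coeff_map_poly)
    then show ?thesis by (simp add: ev_def)
  qed
  have ev_smult: "ev (smult c p) = of_real c * ev p" for c p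
    by (simp add: ev_def map_poly_smult)
  have ev_X: "ev ([:0, 1:] * p) = x * ev p" for p
    by (simp add: ev_def map_poly_pCons)
  have ev_0: "ev 0 = 0" by (simp add: ev_def)
  have "ev ([:0, 1:] * orth_poly a b n) = ev (smult (a (n + 1)) (orth_poly a b (n + 1))
      + smult (b (n + 1)) (orth_poly a b n)
      + (if n = 0 then 0 else smult (a n) (orth_poly a b (n - 1))))"
    using assms by (subst orth_poly_recurrence) auto
  moreover have value_eq: "orth_value a b m x = ev (orth_poly a b m)" for m
    by (simp add: orth_value_def ev_def)
  ultimately show ?thesis
    by (cases "n = 0") (simp_all only: ev_add ev_smult ev_X ev_0 value_eq Suc_eq_plus1 if_True if_False simp_thms)
qed

text \<open>
  The shifted sequence \<open>0, p\<^sub>0, p\<^sub>1, \<dots>\<close> is the solution of the formal eigenvalue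
  equation with first entry 1.
\<close>
lemma green_vector_orth_value_wronskian:
  assumes a_pos: "\<And>n. n \<ge> 1 \<Longrightarrow> a n > 0"
    and w0: "w 0 = 0" and w: "(\<lambda>n. l * w n - jacobi_op a b w n) = delta 1"
  shows "of_real (a (Suc n)) *
      (orth_value a b (Suc n) l * w (Suc n) - orth_value a b n l * w (Suc (Suc n))) = 1"
proof -
  define x where "x = (\<lambda>n. if n = 0 then 0 else orth_value a b (n - 1) l)"
  have x0: "x 0 = 0" by (simp add: x_def)
  have "jacobi_op a b x n = l * x n" for n
  proof (cases n)
    case 0
    then show ?thesis by (simp add: jacobi_op_def x_def)
  next
    case (Suc m)
    then show ?thesis
      using orth_value_recurrence[of a l b m, OF a_pos] x0 by (auto simp: jacobi_op_apply x_def)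
  qed
  then show ?thesis
    using wronskian_constant[where x = x, OF x0 w0 _ w, of n] by (simp add: x_def fun_eq_iff orth_value_0)
qed

section \<open>Values at the origin\<close>

text \<open>
  For small \<open>\<zeta>\<close> boundedness of the coefficients is enough for the Riccati equation to be solvable
  from the first index on, with \<open>\<rho>\<close> proportional to \<open>cmod \<zeta>\<close>.  The product of the solution is
  then the Weyl solution itself, and its factors \<open>t n\<close> tend to 1 as \<open>\<zeta>\<close> tends to 0.
\<close>
lemma weyl_product_near_0:
  assumes a_pos: "\<And>n. n \<ge> 1 \<Longrightarrow> a n > 0"
    and M: "\<And>n. \<bar>a n\<bar> \<le> M" "\<And>n. \<bar>b n\<bar> \<le> M"
    and \<zeta>: "\<zeta> \<noteq> 0" "cmod \<zeta> * (2 * M\<^sup>2 + 3) \<le> 1"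
  obtains t where "\<And>n. cmod (t n - 1) \<le> 2 * (M + 1) * cmod \<zeta>"
    "\<And>n. weyl a b n \<zeta> = weyl_product a t \<zeta> n"
proof -
  define \<rho> where "\<rho> = 2 * (M + 1) * cmod \<zeta>"
  have "0 \<le> M" using M(1)[of 0] by linarith
  then have "0 \<le> \<rho>" by (simp add: \<rho>_def)
  \<comment> \<open>The factor \<open>2 * M\<^sup>2 + 3\<close> bounds \<open>4 * M\<close> and \<open>2 * (M + 1)\<close>, and is also the bound
      \<open>(M\<^sup>2 + 1) * 2 + 1\<close> for the coefficient of \<open>(cmod \<zeta>)\<^sup>2\<close> when \<open>\<rho> \<le> 1\<close>.\<close>
  have "2 * M \<le> M\<^sup>2 + 1" using zero_le_power2[of "M - 1"] by (simp add: power2_diff)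
  moreover have "M\<^sup>2 \<le> 2 * M\<^sup>2" by simp
  ultimately have "2 * (M + 1) \<le> 2 * M\<^sup>2 + 3" by argo
  then have "cmod \<zeta> * (2 * (M + 1)) \<le> cmod \<zeta> * (2 * M\<^sup>2 + 3)"
    by (rule mult_left_mono) simp
  also have "cmod \<zeta> * (2 * (M + 1)) = \<rho>" by (simp add: \<rho>_def mult.commute)
  finally have "\<rho> \<le> 1" using \<zeta>(2) by simp
  have a2: "(a n)\<^sup>2 \<le> M\<^sup>2" for n using power_mono[OF M(1)[of n], of 2] by simp
  have small: "cmod \<zeta> * \<bar>b n\<bar> + (cmod \<zeta>)\<^sup>2 * (\<bar>(a n)\<^sup>2 - 1\<bar> * (1 + \<rho>) + \<rho>) \<le> \<rho> / (1 + \<rho>)" for n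
  proof -
    have "\<bar>(a n)\<^sup>2 - 1\<bar> \<le> M\<^sup>2 + 1" using a2[of n] zero_le_power2[of "a n"] zero_le_power2[of M] by linarith
    then have "\<bar>(a n)\<^sup>2 - 1\<bar> * (1 + \<rho>) + \<rho> \<le> (M\<^sup>2 + 1) * 2 + 1"
      using \<open>0 \<le> \<rho>\<close> \<open>\<rho> \<le> 1\<close> by (intro add_mono mult_mono) auto
    then have square_coeff: "\<bar>(a n)\<^sup>2 - 1\<bar> * (1 + \<rho>) + \<rho> \<le> 2 * M\<^sup>2 + 3" by simp
    have "cmod \<zeta> * \<bar>b n\<bar> + (cmod \<zeta>)\<^sup>2 * (\<bar>(a n)\<^sup>2 - 1\<bar> * (1 + \<rho>) + \<rho>)
        \<le> cmod \<zeta> * M + (cmod \<zeta>)\<^sup>2 * (2 * M\<^sup>2 + 3)"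
      by (intro add_mono[OF mult_left_mono mult_left_mono] M(2) square_coeff) auto
    also have "(cmod \<zeta>)\<^sup>2 * (2 * M\<^sup>2 + 3) = cmod \<zeta> * (cmod \<zeta> * (2 * M\<^sup>2 + 3))"
      by (simp add: power2_eq_square)
    also have "\<dots> \<le> cmod \<zeta> * 1" by (intro mult_left_mono \<zeta>) simp
    also have "cmod \<zeta> * M + cmod \<zeta> * 1 = \<rho> / 2" by (simp add: \<rho>_def algebra_simps)
    also have "\<dots> \<le> \<rho> / (1 + \<rho>)" using \<open>0 \<le> \<rho>\<close> \<open>\<rho> \<le> 1\<close> by (intro divide_left_mono) auto
    finally show ?thesis by simp
  qed
  have contr: "(cmod \<zeta> * a n * (1 + \<rho>))\<^sup>2 \<le> 1 / 4" if "n > 0" for n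
  proof -
    have "4 * M \<le> 2 * M\<^sup>2 + 3" using \<open>2 * M \<le> M\<^sup>2 + 1\<close> by linarith
    then have "cmod \<zeta> * (4 * M) \<le> cmod \<zeta> * (2 * M\<^sup>2 + 3)" by (intro mult_left_mono) auto
    then have "cmod \<zeta> * M * 2 \<le> 1 / 2" using \<zeta>(2) by simp
    moreover have "cmod \<zeta> * a n * (1 + \<rho>) \<le> cmod \<zeta> * M * 2"
      using \<open>0 \<le> \<rho>\<close> \<open>\<rho> \<le> 1\<close> M(1)[of n] \<open>0 \<le> M\<close> by (intro mult_mono mult_left_mono) auto
    ultimately have "(cmod \<zeta> * a n * (1 + \<rho>))\<^sup>2 \<le> (1 / 2)\<^sup>2"
      using a_pos[of n] that \<open>0 \<le> \<rho>\<close> by (intro power_mono) auto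
    then show ?thesis by (simp add: power2_eq_square)
  qed
  have quarter: "(1 / 4 :: real) < 1" by simp
  obtain t where t: "\<And>n. cmod (t n - 1) \<le> \<rho>"
    "\<And>n. n \<ge> 0 \<Longrightarrow> t n * (1 + \<zeta>\<^sup>2 - \<zeta> * of_real (b (Suc n))
        - \<zeta>\<^sup>2 * (of_real (a (Suc n)))\<^sup>2 * t (Suc n)) = 1"
  proof (rule riccati_solution[where N = 0 and q = "1 / 4" and z = \<zeta> and a = a and b = b,
        OF \<open>0 \<le> \<rho>\<close> quarter small contr])
    fix t
    assume "\<And>n. cmod (t n - 1) \<le> \<rho>"
      "\<And>n. n \<ge> 0 \<Longrightarrow> t n * (1 + \<zeta>\<^sup>2 - \<zeta> * of_real (b (Suc n))
        - \<zeta>\<^sup>2 * (of_real (a (Suc n)))\<^sup>2 * t (Suc n)) = 1"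
    then show thesis by (rule that)
  qed
  let ?w = "weyl_product a t \<zeta>"
  have w2: "?w \<in> ell2"
    by (rule weyl_product_in_ell2[where q = "1 / 4" and N = 0, OF quarter t(1) a_pos contr])
  have "(\<zeta> + inverse \<zeta>) * ?w n - jacobi_op a b ?w n = delta 1 n" for n
  proof (cases "n = 0")
    case True
    then show ?thesis using w2 by (simp add: ell2_iff jacobi_op_def delta_def)
  next
    case False
    then show ?thesis
      using weyl_product_recurrence[where N = 0 and t = t and a = a and b = b, OF \<zeta>(1) _ t(2), of n]
      by simp
  qed
  then have w: "(\<lambda>n. (\<zeta> + inverse \<zeta>) * ?w n - jacobi_op a b ?w n) = delta 1" by blast
  have "Bseq a" using M(1) by (intro BseqI'[of _ M]) simp
  then have "weyl a b n \<zeta> = ?w n" for n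
    using weyl_eq_green_vector[OF a_pos _ w2 w] by blast
  then show thesis using that[of t] t(1) by (simp add: \<rho>_def)
qed

text \<open>
  At index 0 the Weyl solution carries the default value 0, so the formula starts at index 1.
\<close>
lemma weyl_norm_at_0:
  assumes a_pos: "\<And>n. n \<ge> 1 \<Longrightarrow> a n > 0" and "Bseq a" "Bseq b" and n: "n \<ge> 1"
  shows "weyl_norm a b n 0 = of_real (\<Prod>k=1..<n. a k)"
proof -
  obtain Ma Mb where "\<And>n. \<bar>a n\<bar> \<le> Ma" "\<And>n. \<bar>b n\<bar> \<le> Mb"
    using assms(2,3) by (auto simp: Bseq_def)
  then obtain M where M: "\<And>n. \<bar>a n\<bar> \<le> M" "\<And>n. \<bar>b n\<bar> \<le> M"
    by (meson max.cobounded1 max.cobounded2 order_trans)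
  let ?near = "\<lambda>\<zeta>. \<zeta> \<noteq> 0 \<and> cmod \<zeta> * (2 * M\<^sup>2 + 3) \<le> 1"
  have "\<exists>t. ?near \<zeta> \<longrightarrow> (\<forall>n. cmod (t n - 1) \<le> 2 * (M + 1) * cmod \<zeta>)
      \<and> (\<forall>n. weyl a b n \<zeta> = weyl_product a t \<zeta> n)" for \<zeta>
    using weyl_product_near_0[of a M b \<zeta>, OF a_pos M] by metis
  then obtain T where T: "\<And>\<zeta> n. ?near \<zeta> \<Longrightarrow> cmod (T \<zeta> n - 1) \<le> 2 * (M + 1) * cmod \<zeta>"
      "\<And>\<zeta> n. ?near \<zeta> \<Longrightarrow> weyl a b n \<zeta> = weyl_product a (T \<zeta>) \<zeta> n"
    by metis
  have "((\<lambda>\<zeta>. cmod \<zeta> * (2 * M\<^sup>2 + 3)) \<longlongrightarrow> cmod 0 * (2 * M\<^sup>2 + 3)) (at 0)"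
    by (intro tendsto_intros)
  then have "\<forall>\<^sub>F \<zeta> in at 0. cmod \<zeta> * (2 * M\<^sup>2 + 3) < 1"
    by (rule order_tendstoD(2)) simp
  with eventually_neq_at_within[of 0] have near: "\<forall>\<^sub>F \<zeta> in at 0. ?near \<zeta>"
    by eventually_elim simp
  have T_lim: "((\<lambda>\<zeta>. T \<zeta> k) \<longlongrightarrow> 1) (at 0)" for k
  proof (rule LIM_zero_cancel, rule Lim_null_comparison)
    show "\<forall>\<^sub>F \<zeta> in at 0. norm (T \<zeta> k - 1) \<le> 2 * (M + 1) * cmod \<zeta>"
      using near by eventually_elim (rule T(1))
    have "((\<lambda>\<zeta>. 2 * (M + 1) * cmod \<zeta>) \<longlongrightarrow> 2 * (M + 1) * cmod 0) (at 0)"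
      by (intro tendsto_intros)
    then show "((\<lambda>\<zeta>. 2 * (M + 1) * cmod \<zeta>) \<longlongrightarrow> 0) (at 0)" by simp
  qed
  have "((\<lambda>\<zeta>. (\<Prod>k<n. T \<zeta> k) * of_real (\<Prod>k=1..<n. a k))
      \<longlongrightarrow> (\<Prod>k<n. 1) * of_real (\<Prod>k=1..<n. a k)) (at 0)"
    by (intro tendsto_intros T_lim)
  moreover have "\<forall>\<^sub>F \<zeta> in at 0. (\<Prod>k<n. T \<zeta> k) * of_real (\<Prod>k=1..<n. a k)
      = inverse (\<zeta> ^ n) * weyl a b n \<zeta>"
    using near
  proof eventually_elim
    case (elim \<zeta>)
    then show ?case using T(2)[OF elim, of n] n by (simp add: weyl_product_def)
  qed
  ultimately have "((\<lambda>\<zeta>. inverse (\<zeta> ^ n) * weyl a b n \<zeta>) \<longlongrightarrow> of_real (\<Prod>k=1..<n. a k)) (at 0)"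
    by (simp add: tendsto_cong)
  then show ?thesis by (simp add: weyl_norm_def tendsto_Lim)
qed

text \<open>
  Multiplied by \<open>\<zeta> ^ (n + 1)\<close>, the three-term recurrence has coefficients that are polynomials
  in \<open>\<zeta>\<close>, and the term coming from two indices below carries a factor \<open>\<zeta>\<^sup>2\<close>.  In the limit only
  the division by \<open>a (n + 1)\<close> remains in each step.
\<close>
lemma c_norm_at_0:
  assumes a_pos: "\<And>n. n \<ge> 1 \<Longrightarrow> a n > 0"
  shows "c_norm a b n 0 = inverse (of_real (\<Prod>k=1..n. a k))"
proof -
  define f where "f = (\<lambda>n \<zeta>. \<zeta> ^ n * orth_value a b n (\<zeta> + inverse \<zeta>))"
  let ?A = "\<lambda>n. inverse (complex_of_real (\<Prod>k=1..n. a k))"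
  have rec: "f (Suc m) \<zeta> = inverse (of_real (a (Suc m))) * ((1 + \<zeta>\<^sup>2 - of_real (b (Suc m)) * \<zeta>) * f m \<zeta>
      - (if m = 0 then 0 else of_real (a m) * \<zeta>\<^sup>2 * f (m - 1) \<zeta>))" if "\<zeta> \<noteq> 0" for m \<zeta>
  proof -
    let ?x = "\<zeta> + inverse \<zeta>"
    have "of_real (a (Suc m)) * orth_value a b (Suc m) ?x
        = (?x - of_real (b (Suc m))) * orth_value a b m ?x
        - (if m = 0 then 0 else of_real (a m) * orth_value a b (m - 1) ?x)"
      using orth_value_recurrence[of a ?x b m, OF a_pos] by (simp add: algebra_simps)
    then have "of_real (a (Suc m)) * f (Suc m) \<zeta> = \<zeta> ^ Suc m * ((?x - of_real (b (Suc m))) * orth_value a b m ?x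
        - (if m = 0 then 0 else of_real (a m) * orth_value a b (m - 1) ?x))"
      by (simp add: f_def)
    also have "\<dots> = (\<zeta> * ?x - of_real (b (Suc m)) * \<zeta>) * f m \<zeta>
        - (if m = 0 then 0 else of_real (a m) * \<zeta>\<^sup>2 * f (m - 1) \<zeta>)"
      by (cases m) (simp_all add: f_def algebra_simps power2_eq_square)
    also have "\<zeta> * ?x = 1 + \<zeta>\<^sup>2" using that by (simp add: field_simps power2_eq_square)
    finally show ?thesis using a_pos[of "Suc m"] by (simp add: field_simps)
  qed
  have "(f n \<longlongrightarrow> ?A n) (at 0) \<and> (f (Suc n) \<longlongrightarrow> ?A (Suc n)) (at 0)"
  proof -
    have step: "(f (Suc m) \<longlongrightarrow> ?A (Suc m)) (at 0)"
      if lim: "(f m \<longlongrightarrow> ?A m) (at 0)" and lim': "m \<noteq> 0 \<Longrightarrow> (f (m - 1) \<longlongrightarrow> ?A (m - 1)) (at 0)" for m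
    proof -
      let ?g = "\<lambda>\<zeta>. inverse (of_real (a (Suc m))) * ((1 + \<zeta>\<^sup>2 - of_real (b (Suc m)) * \<zeta>) * f m \<zeta>
        - (if m = 0 then 0 else of_real (a m) * \<zeta>\<^sup>2 * f (m - 1) \<zeta>))"
      have "((\<lambda>\<zeta>. if m = 0 then 0 else of_real (a m) * \<zeta>\<^sup>2 * f (m - 1) \<zeta>) \<longlongrightarrow> 0) (at 0)"
        using lim' by (cases "m = 0") (auto intro!: tendsto_eq_intros)
      then have "(?g \<longlongrightarrow> inverse (of_real (a (Suc m))) * ((1 + 0\<^sup>2 - of_real (b (Suc m)) * 0) * ?A m - 0)) (at 0)"
        by (intro tendsto_intros lim)
      moreover have "\<forall>\<^sub>F \<zeta> in at 0. ?g \<zeta> = f (Suc m) \<zeta>"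
        using eventually_neq_at_within[of 0] by eventually_elim (simp add: rec)
      ultimately show ?thesis by (simp add: tendsto_cong mult.commute)
    qed
    have f0: "(f 0 \<longlongrightarrow> ?A 0) (at 0)" by (simp add: f_def orth_value_0)
    show ?thesis
    proof (induction n)
      case 0
      show ?case using f0 step[of 0] by blast
    next
      case (Suc n)
      then show ?case using step[of "Suc n"] by simp
    qed
  qed
  then show ?thesis
    unfolding c_norm_def f_def orth_value_def by (simp add: tendsto_Lim)
qed

section \<open>The Wronskian identity and the limits\<close>

text \<open>
  For \<open>z \<noteq> 0\<close> this is the constancy of the Wronskian, with the powers of \<open>z\<close> distributed,
  and square summability of the Weyl solution.  For \<open>z = 0\<close> it says that
  \<open>inverse (a 1 * \<dots> * a (n + 1))\<close>, \<open>a 1 * \<dots> * a n\<close> and \<open>a (n + 1)\<close> have product 1, the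
  second summand being 0.
\<close>
lemma normalized_wronskian:
  fixes a b :: "nat \<Rightarrow> real" and z :: complex
  assumes a_pos: "\<And>n. n \<ge> 1 \<Longrightarrow> a n > 0" and a_lim: "a \<longlonglongrightarrow> 1" and b_lim: "b \<longlonglongrightarrow> 0"
    and z_disc: "cmod z < 1"
    and not_eigenvalue: "z \<noteq> 0 \<Longrightarrow> \<not> jacobi_eigenvalue a b (z + inverse z)"
  shows "of_real (a (Suc n)) * (c_norm a b (Suc n) z * weyl_norm a b (Suc n) z
      - z\<^sup>2 * c_norm a b n z * weyl_norm a b (Suc (Suc n)) z) = 1"
    and "(\<lambda>n. z ^ n * weyl_norm a b n z) \<longlonglongrightarrow> 0"
proof -
  have "Bseq a" "Bseq b"
    by (rule convergent_imp_Bseq, rule convergentI, rule a_lim b_lim)+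
  have "of_real (a (Suc n)) * (c_norm a b (Suc n) z * weyl_norm a b (Suc n) z
      - z\<^sup>2 * c_norm a b n z * weyl_norm a b (Suc (Suc n)) z) = 1
    \<and> (\<lambda>n. z ^ n * weyl_norm a b n z) \<longlonglongrightarrow> 0"
  proof (cases "z = 0")
    case True
    have "a k \<noteq> 0" if "k \<ge> 1" for k using a_pos[OF that] by simp
    then have "(\<Prod>k=1..<Suc n. a k) \<noteq> 0" by auto
    then have "of_real (a (Suc n)) * (c_norm a b (Suc n) 0 * weyl_norm a b (Suc n) 0) = (1::complex)"
      using a_pos[of "Suc n"]
      by (simp add: c_norm_at_0[OF a_pos] weyl_norm_at_0[OF a_pos \<open>Bseq a\<close> \<open>Bseq b\<close>]
        atLeastLessThanSuc_atLeastAtMost field_simps)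
    moreover have "(\<lambda>n. (0::complex) ^ n * weyl_norm a b n 0) \<longlonglongrightarrow> 0"
      by (rule tendsto_eventually, rule eventually_sequentiallyI[of 1]) auto
    ultimately show ?thesis using True by simp
  next
    case False
    obtain w where w2: "w \<in> ell2" and w: "(\<lambda>n. (z + inverse z) * w n - jacobi_op a b w n) = delta 1"
      using green_vector_exists[OF a_pos a_lim b_lim z_disc False not_eigenvalue[OF False]] by blast
    have y: "weyl_norm a b n z = inverse (z ^ n) * w n" for n
      using False weyl_eq_green_vector[OF a_pos \<open>Bseq a\<close> w2 w] by (simp add: weyl_norm_def)
    have c: "c_norm a b n z = z ^ n * orth_value a b n (z + inverse z)" for n
      using False by (simp add: c_norm_def orth_value_def)
    have "w 0 = 0" using w2 by (simp add: ell2_iff)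
    from green_vector_orth_value_wronskian[OF a_pos this w, of n]
    have "of_real (a (Suc n)) * (c_norm a b (Suc n) z * weyl_norm a b (Suc n) z
      - z\<^sup>2 * c_norm a b n z * weyl_norm a b (Suc (Suc n)) z) = 1"
      using False by (simp add: y c field_simps power2_eq_square)
    moreover have "(\<lambda>n. z ^ n * weyl_norm a b n z) = w" using False by (simp add: y fun_eq_iff)
    ultimately show ?thesis using ell2_tendsto_0[OF w2] by simp
  qed
  then show "of_real (a (Suc n)) * (c_norm a b (Suc n) z * weyl_norm a b (Suc n) z
      - z\<^sup>2 * c_norm a b n z * weyl_norm a b (Suc (Suc n)) z) = 1"
    and "(\<lambda>n. z ^ n * weyl_norm a b n z) \<longlonglongrightarrow> 0" by blast+
qed

context
  fixes a c y :: "nat \<Rightarrow> complex" and z :: complex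
  assumes a: "a \<longlonglongrightarrow> 1" "\<And>n. a (Suc n) \<noteq> 0" and z: "norm z < 1"
    and wronskian: "\<And>n. a (Suc n) * (c (Suc n) * y (Suc n) - z\<^sup>2 * c n * y (Suc (Suc n))) = 1"
begin

text \<open>
  Solved for \<open>c (Suc n)\<close>, the relation is a forward recursion whose multiplier tends to
  \<open>z\<^sup>2\<close>.
\<close>
lemma wronskian_forward_limit:
  assumes y: "y \<longlonglongrightarrow> L" and L: "L \<noteq> 0"
  shows "c \<longlonglongrightarrow> 1 / (L * (1 - z\<^sup>2))"
proof -
  note y1 = LIMSEQ_Suc[OF y] and y2 = LIMSEQ_Suc[OF LIMSEQ_Suc[OF y]] and a1 = LIMSEQ_Suc[OF a(1)]
  have z2: "norm (z\<^sup>2) < 1" using z by (simp add: norm_power power_less_one_iff)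
  have "c \<longlonglongrightarrow> (1 / (1 * L)) / (1 - z\<^sup>2)"
  proof (rule tendsto_of_forward_recursion)
    show "(\<lambda>n. 1 / (a (Suc n) * y (Suc n))) \<longlonglongrightarrow> 1 / (1 * L)"
      by (intro tendsto_intros a1 y1) (use L in simp)
    have "(\<lambda>n. z\<^sup>2 * (y (Suc (Suc n)) / y (Suc n))) \<longlonglongrightarrow> z\<^sup>2 * (L / L)"
      by (intro tendsto_intros y1 y2 L)
    then show "(\<lambda>n. z\<^sup>2 * (y (Suc (Suc n)) / y (Suc n))) \<longlonglongrightarrow> z\<^sup>2" using L by simp
    show "\<forall>\<^sub>F n in sequentially. c (Suc n)
        = 1 / (a (Suc n) * y (Suc n)) + z\<^sup>2 * (y (Suc (Suc n)) / y (Suc n)) * c n"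
      using tendsto_imp_eventually_ne[OF y1 L]
    proof eventually_elim
      case (elim n)
      then show ?case using wronskian[of n] a(2)[of n] by (simp add: field_simps)
    qed
  qed (rule z2)
  then show ?thesis by simp
qed

text \<open>
  Solved for \<open>y (Suc n)\<close>, the relation is a backward recursion whose multiplier tends to
  \<open>z\<^sup>2\<close>.  The growth condition on \<open>y\<close> fits the rate \<open>norm z\<close>, which exceeds
  \<open>norm (z\<^sup>2)\<close> unless \<open>z = 0\<close>; in that case there is no recursion left.
\<close>
lemma wronskian_backward_limit:
  assumes c: "c \<longlonglongrightarrow> C" and C: "C \<noteq> 0" and growth: "(\<lambda>n. z ^ n * y n) \<longlonglongrightarrow> 0"
  shows "y \<longlonglongrightarrow> 1 / (C * (1 - z\<^sup>2))"
proof -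
  note c1 = LIMSEQ_Suc[OF c] and a1 = LIMSEQ_Suc[OF a(1)]
  let ?f = "\<lambda>n. 1 / (a (Suc n) * c (Suc n))" and ?g = "\<lambda>n. z\<^sup>2 * (c n / c (Suc n))"
  have f: "?f \<longlonglongrightarrow> 1 / (1 * C)" by (intro tendsto_intros a1 c1) (use C in simp)
  have "?g \<longlonglongrightarrow> z\<^sup>2 * (C / C)" by (intro tendsto_intros c1 c C)
  then have g: "?g \<longlonglongrightarrow> z\<^sup>2" using C by simp
  have rec: "\<forall>\<^sub>F n in sequentially. y (Suc n) = ?f n + ?g n * y (Suc (Suc n))"
    using tendsto_imp_eventually_ne[OF c1 C]
  proof eventually_elim
    case (elim n)
    then show ?case using wronskian[of n] a(2)[of n] by (simp add: field_simps)
  qed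
  have "(\<lambda>n. y (Suc n)) \<longlonglongrightarrow> 1 / (1 * C) / (1 - z\<^sup>2)"
  proof (cases "z = 0")
    case True
    then have "\<forall>\<^sub>F n in sequentially. ?f n = y (Suc n)" by (intro eventually_mono[OF rec]) simp
    from Lim_transform_eventually[OF f this] show ?thesis using True by simp
  next
    case False
    show ?thesis
    proof (rule tendsto_of_backward_recursion[OF f g _ z])
      show "norm (z\<^sup>2) < norm z" using z False by (simp add: norm_mult power2_eq_square)
      have "(\<lambda>n. norm (z ^ Suc n * y (Suc n)) / norm z) \<longlonglongrightarrow> norm (0::complex) / norm z"
        by (intro tendsto_intros LIMSEQ_Suc[OF growth]) (use False in simp)
      then show "(\<lambda>n. norm z ^ n * norm (y (Suc n))) \<longlonglongrightarrow> 0"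
        using False by (simp add: norm_mult norm_power mult.assoc)
    qed (rule rec)
  qed
  then show ?thesis by (simp add: LIMSEQ_imp_Suc)
qed

end

theorem theorem2p2:
  fixes a b :: "nat \<Rightarrow> real" and z :: complex
  assumes a_pos: "\<And>n. n \<ge> 1 \<Longrightarrow> a n > 0"
    and a_lim: "a \<longlonglongrightarrow> 1"
    and b_lim: "b \<longlonglongrightarrow> 0"
    and z_disc: "cmod z < 1"
    and not_eigenvalue: "z \<noteq> 0 \<Longrightarrow> \<not> jacobi_eigenvalue a b (z + inverse z)"
  shows "(nonzero_limit (\<lambda>n. weyl_norm a b n z) \<longleftrightarrow> nonzero_limit (\<lambda>n. c_norm a b n z))
       \<and> (nonzero_limit (\<lambda>n. weyl_norm a b n z) \<or> nonzero_limit (\<lambda>n. c_norm a b n z)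
            \<longrightarrow> (\<lambda>n. c_norm a b n z) \<longlonglongrightarrow> jost_u a b z / (1 - z\<^sup>2))"
proof -
  let ?c = "\<lambda>n. c_norm a b n z" and ?y = "\<lambda>n. weyl_norm a b n z"
  have A: "(\<lambda>n. complex_of_real (a n)) \<longlonglongrightarrow> 1"
    using tendsto_of_real[OF a_lim, where ?'a = complex] by simp
  have A0: "complex_of_real (a (Suc n)) \<noteq> 0" for n using a_pos[of "Suc n"] by simp
  note W = normalized_wronskian[OF a_pos a_lim b_lim z_disc not_eigenvalue]
  have z2: "1 - z\<^sup>2 \<noteq> 0"
  proof
    assume "1 - z\<^sup>2 = 0"
    then have "(cmod z)\<^sup>2 = 1" by (simp flip: norm_power)
    then have "cmod z = 1 \<or> cmod z = - 1" by (simp add: power2_eq_1_iff)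
    then show False using z_disc norm_ge_zero[of z] by linarith
  qed
  have forward: "?c \<longlonglongrightarrow> 1 / (L * (1 - z\<^sup>2))" if "?y \<longlonglongrightarrow> L" "L \<noteq> 0" for L
    using wronskian_forward_limit[OF A A0 z_disc W(1) that] .
  have backward: "?y \<longlonglongrightarrow> 1 / (C * (1 - z\<^sup>2))" if "?c \<longlonglongrightarrow> C" "C \<noteq> 0" for C
    using wronskian_backward_limit[OF A A0 z_disc W(1) that W(2)] .
  have iff: "nonzero_limit ?y \<longleftrightarrow> nonzero_limit ?c"
  proof
    assume "nonzero_limit ?y"
    then obtain L where "L \<noteq> 0" "?y \<longlonglongrightarrow> L" by (auto simp: nonzero_limit_def)
    then show "nonzero_limit ?c"
      unfolding nonzero_limit_def using forward z2 by (intro exI[of _ "1 / (L * (1 - z\<^sup>2))"]) auto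
  next
    assume "nonzero_limit ?c"
    then obtain C where "C \<noteq> 0" "?c \<longlonglongrightarrow> C" by (auto simp: nonzero_limit_def)
    then show "nonzero_limit ?y"
      unfolding nonzero_limit_def using backward z2 by (intro exI[of _ "1 / (C * (1 - z\<^sup>2))"]) auto
  qed
  moreover have "?c \<longlonglongrightarrow> jost_u a b z / (1 - z\<^sup>2)" if "nonzero_limit ?y"
  proof -
    obtain L where L: "L \<noteq> 0" "?y \<longlonglongrightarrow> L" using \<open>nonzero_limit ?y\<close> by (auto simp: nonzero_limit_def)
    then have "jost_u a b z = 1 / L" by (simp add: jost_u_def limI inverse_eq_divide)
    then show ?thesis using forward[OF L(2,1)] by simp
  qed
  ultimately show ?thesis by blast
qed

end
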